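(* Let $M$ be an oriented smooth 3-manifold with a plane field $\mathcal D$ and a vector field $T$ transverse to $\mathcal D$, let $\omega$ be the 1-form with $\ker\omega=\mathcal D$, $\omega(T)=1$, let $\eta=\iota_T\,d\omega$, and let $g$ be a Riemannian metric on $M$ compatible with $(\mathcal D,T)$. Then, on the open set $U$ where the curvature $k$ of $T$-curves is nonzero, $$\eta\wedge d\eta=-k^2(\tau-h_{B,N})\,dV_g .$$ Consequently, if $M$ is closed, then $$\mathrm{gv}(\mathcal D,T):=\int_M\eta\wedge d\eta=-\int_M k^2(\tau-h_{B,N})\,dV_g,$$ where the integrand on the right is taken to be $0$ where $k=0$.
   Context: A Riemannian metric $g$ is compatible with $(\mathcal D,T)$ if $T$ is the unit normal to $\mathcal D$, i.e. $\omega(X)=g(T,X)$ for all vector fields $X$. $\nabla$ is the Levi-Civita connection; $T$-curves are integral curves of $T$; on $U$ the principal normal $N$, the binormal $B=T\times N$ (so $(T,N,B)$ is a positively oriented orthonormal frame) and the torsion $\tau$ of $T$-curves are defined by $\nabla_TT=kN$, $\nabla_TN=-kT+\tau B$, $\nabla_TB=-\tau N$ with $k>0$. The non-symmetric second fundamental form of $\mathcal D$ is $h_{X,Y}=g(\nabla_XY,T)$ for $X,Y$ tangent to $\mathcal D$. $\mathcal D$ is not assumed integrable. *)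

theory Defs
  imports "HOL-Analysis.Analysis"
begin

text \<open>
  Tensor calculus on a smooth 3-manifold in its classical form. The manifold is the whole
  type \<open>'a\<close>. A tensor field is a family of components, one for each chart \<open>c\<close> of the atlas and
  each point \<open>p\<close> of the domain of \<open>c\<close>, subject to the transformation law between charts.
  Values at \<open>(c, p)\<close> with \<open>c\<close> outside the atlas or \<open>p\<close> outside the domain of \<open>c\<close> are irrelevant.
\<close>

subsection \<open>Smooth manifolds\<close>

primrec Ck_on :: "nat \<Rightarrow> (real^'n) set \<Rightarrow> (real^'n \<Rightarrow> 'b::real_normed_vector) \<Rightarrow> bool" where
  "Ck_on 0 S f \<longleftrightarrow> continuous_on S f"
| "Ck_on (Suc n) S f \<longleftrightarrow>
     (\<forall>x\<in>S. f differentiable (at x)) \<and>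
     (\<forall>i. Ck_on n S (\<lambda>x. frechet_derivative f (at x) (axis i 1)))"

definition Cinf_on :: "(real^'n) set \<Rightarrow> (real^'n \<Rightarrow> 'b::real_normed_vector) \<Rightarrow> bool" where
  "Cinf_on S f \<longleftrightarrow> (\<forall>n. Ck_on n S f)"

type_synonym 'a chart = "'a set \<times> ('a \<Rightarrow> real^3)"

abbreviation chart_dom :: "'a chart \<Rightarrow> 'a set" where "chart_dom c \<equiv> fst c"

abbreviation chart_map :: "'a chart \<Rightarrow> 'a \<Rightarrow> real^3" where "chart_map c \<equiv> snd c"

definition chart_inv :: "'a chart \<Rightarrow> real^3 \<Rightarrow> 'a" where
  "chart_inv c = inv_into (chart_dom c) (chart_map c)"

definition is_chart :: "('a::topological_space) chart \<Rightarrow> bool" where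
  "is_chart c \<longleftrightarrow> open (chart_dom c) \<and> open (chart_map c ` chart_dom c) \<and>
     homeomorphism (chart_dom c) (chart_map c ` chart_dom c) (chart_map c) (chart_inv c)"

text \<open>The derivative of \<open>f\<close> at \<open>p\<close> along the vector with components \<open>v\<close> in the chart \<open>c\<close>.
  For \<open>f = chart_map c'\<close> this is the Jacobian of the transition map from \<open>c\<close> to \<open>c'\<close>.\<close>

definition chart_deriv ::
    "'a chart \<Rightarrow> ('a \<Rightarrow> 'b::real_normed_vector) \<Rightarrow> 'a \<Rightarrow> real^3 \<Rightarrow> 'b" where
  "chart_deriv c f p v = frechet_derivative (f \<circ> chart_inv c) (at (chart_map c p)) v"

definition smooth_in_chart ::
    "'a chart \<Rightarrow> 'a set \<Rightarrow> ('a \<Rightarrow> 'b::real_normed_vector) \<Rightarrow> bool" where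
  "smooth_in_chart c W f \<longleftrightarrow> Cinf_on (chart_map c ` (W \<inter> chart_dom c)) (f \<circ> chart_inv c)"

text \<open>An oriented smooth 3-manifold is a Hausdorff second countable space with an atlas of
  smoothly compatible charts whose transition maps preserve the orientation of \<open>\<real>\<^sup>3\<close>;
  the atlas need not be maximal.\<close>

definition oriented_atlas ::
    "('a::{t2_space,second_countable_topology}) chart set \<Rightarrow> bool" where
  "oriented_atlas A \<longleftrightarrow>
     (\<forall>c\<in>A. is_chart c) \<and> (\<Union>c\<in>A. chart_dom c) = UNIV \<and>
     (\<forall>c\<in>A. \<forall>c'\<in>A. smooth_in_chart c (chart_dom c') (chart_map c')) \<and>
     (\<forall>c\<in>A. \<forall>c'\<in>A. \<forall>p\<in>chart_dom c \<inter> chart_dom c'.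
        det (matrix (chart_deriv c (chart_map c') p)) > 0)"


subsection \<open>Vector fields, plane fields and differential forms\<close>

type_synonym 'a vfield = "'a chart \<Rightarrow> 'a \<Rightarrow> real^3"
type_synonym 'a form1 = "'a chart \<Rightarrow> 'a \<Rightarrow> real^3 \<Rightarrow> real"
type_synonym 'a form2 = "'a chart \<Rightarrow> 'a \<Rightarrow> real^3 \<Rightarrow> real^3 \<Rightarrow> real"
type_synonym 'a form3 = "'a chart \<Rightarrow> 'a \<Rightarrow> real^3 \<Rightarrow> real^3 \<Rightarrow> real^3 \<Rightarrow> real"

definition vector_field ::
    "('a::topological_space) chart set \<Rightarrow> 'a set \<Rightarrow> 'a vfield \<Rightarrow> bool" where
  "vector_field A W X \<longleftrightarrow> open W \<and>
     (\<forall>c\<in>A. smooth_in_chart c W (X c)) \<and>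
     (\<forall>c\<in>A. \<forall>c'\<in>A. \<forall>p\<in>W \<inter> chart_dom c \<inter> chart_dom c'.
        X c' p = chart_deriv c (chart_map c') p (X c p))"

definition plane_field ::
    "('a::topological_space) chart set \<Rightarrow> ('a chart \<Rightarrow> 'a \<Rightarrow> (real^3) set) \<Rightarrow> bool" where
  "plane_field A D \<longleftrightarrow>
     (\<forall>c\<in>A. \<forall>p\<in>chart_dom c. subspace (D c p) \<and> dim (D c p) = 2) \<and>
     (\<forall>c\<in>A. \<forall>c'\<in>A. \<forall>p\<in>chart_dom c \<inter> chart_dom c'.
        D c' p = chart_deriv c (chart_map c') p ` D c p) \<and>
     (\<forall>p. \<exists>W X Y. p \<in> W \<and> vector_field A W X \<and> vector_field A W Y \<and>
        (\<forall>c\<in>A. \<forall>q\<in>W \<inter> chart_dom c. D c q = span {X c q, Y c q}))"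

definition transverse ::
    "'a chart set \<Rightarrow> ('a chart \<Rightarrow> 'a \<Rightarrow> (real^3) set) \<Rightarrow> 'a vfield \<Rightarrow> bool" where
  "transverse A D T \<longleftrightarrow> (\<forall>c\<in>A. \<forall>p\<in>chart_dom c. T c p \<notin> D c p)"

text \<open>The 1-form \<open>\<omega>\<close> with kernel \<open>D\<close> and \<open>\<omega>(T) = 1\<close>.\<close>

definition defining_form ::
    "('a chart \<Rightarrow> 'a \<Rightarrow> (real^3) set) \<Rightarrow> 'a vfield \<Rightarrow> 'a form1" where
  "defining_form D T c p =
     (THE l. linear l \<and> {v. l v = 0} = D c p \<and> l (T c p) = 1)"

text \<open>Conventions: \<open>d\<alpha>(X,Y) = X(\<alpha>(Y)) - Y(\<alpha>(X)) - \<alpha>([X,Y])\<close>, written here on vectors \<open>u\<close>, \<open>v\<close>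
  extended with constant components, and \<open>(dx\<^sub>1 \<and> dx\<^sub>2 \<and> dx\<^sub>3)(e\<^sub>1,e\<^sub>2,e\<^sub>3) = 1\<close>.\<close>

definition ext_deriv :: "'a form1 \<Rightarrow> 'a form2" where
  "ext_deriv \<alpha> c p u v =
     chart_deriv c (\<lambda>q. \<alpha> c q v) p u - chart_deriv c (\<lambda>q. \<alpha> c q u) p v"

definition contract :: "'a vfield \<Rightarrow> 'a form2 \<Rightarrow> 'a form1" where
  "contract X \<beta> c p v = \<beta> c p (X c p) v"

definition wedge :: "'a form1 \<Rightarrow> 'a form2 \<Rightarrow> 'a form3" where
  "wedge \<alpha> \<beta> c p u v w =
     \<alpha> c p u * \<beta> c p v w + \<alpha> c p v * \<beta> c p w u + \<alpha> c p w * \<beta> c p u v"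

definition eta_form ::
    "('a chart \<Rightarrow> 'a \<Rightarrow> (real^3) set) \<Rightarrow> 'a vfield \<Rightarrow> 'a form1" where
  "eta_form D T = contract T (ext_deriv (defining_form D T))"


subsection \<open>Integration of 3-forms on closed oriented manifolds\<close>

definition partition_of_unity ::
    "('a::topological_space) chart set \<Rightarrow> 'a chart set \<Rightarrow> ('a chart \<Rightarrow> 'a \<Rightarrow> real) \<Rightarrow> bool" where
  "partition_of_unity A F \<rho> \<longleftrightarrow> finite F \<and> F \<subseteq> A \<and>
     (\<forall>c\<in>F. (\<forall>c'\<in>A. smooth_in_chart c' UNIV (\<rho> c)) \<and> (\<forall>p. 0 \<le> \<rho> c p) \<and>
        closure {p. \<rho> c p \<noteq> 0} \<subseteq> chart_dom c) \<and>
     (\<forall>p. (\<Sum>c\<in>F. \<rho> c p) = 1)"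

text \<open>A finite smooth partition of unity subordinate to the atlas exists when the manifold is
  compact; for a continuous 3-form the value below does not depend on which one is chosen.\<close>

definition form_integral :: "('a::topological_space) chart set \<Rightarrow> 'a form3 \<Rightarrow> real" where
  "form_integral A \<theta> =
     (let (F, \<rho>) = (SOME (F, \<rho>). partition_of_unity A F \<rho>) in
      \<Sum>c\<in>F. LINT x:chart_map c ` chart_dom c|lborel.
        \<rho> c (chart_inv c x) * \<theta> c (chart_inv c x) (axis 1 1) (axis 2 1) (axis 3 1))"

definition godbillon_vey ::
    "('a::topological_space) chart set \<Rightarrow> ('a chart \<Rightarrow> 'a \<Rightarrow> (real^3) set) \<Rightarrow> 'a vfield \<Rightarrow> real" where
  "godbillon_vey A D T = form_integral A (wedge (eta_form D T) (ext_deriv (eta_form D T)))"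


subsection \<open>Riemannian metrics and the Levi-Civita connection\<close>

type_synonym 'a metric_field = "'a chart \<Rightarrow> 'a \<Rightarrow> real^3 \<Rightarrow> real^3 \<Rightarrow> real"

definition riemannian_metric ::
    "('a::topological_space) chart set \<Rightarrow> 'a metric_field \<Rightarrow> bool" where
  "riemannian_metric A g \<longleftrightarrow>
     (\<forall>c\<in>A. \<forall>p\<in>chart_dom c. bilinear (g c p) \<and> (\<forall>u v. g c p u v = g c p v u) \<and>
        (\<forall>u. u \<noteq> 0 \<longrightarrow> g c p u u > 0)) \<and>
     (\<forall>c\<in>A. \<forall>u v. smooth_in_chart c UNIV (\<lambda>p. g c p u v)) \<and>
     (\<forall>c\<in>A. \<forall>c'\<in>A. \<forall>p\<in>chart_dom c \<inter> chart_dom c'. \<forall>u v.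
        g c' p (chart_deriv c (chart_map c') p u) (chart_deriv c (chart_map c') p v) = g c p u v)"

definition compatible_metric ::
    "'a chart set \<Rightarrow> ('a chart \<Rightarrow> 'a \<Rightarrow> (real^3) set) \<Rightarrow> 'a vfield \<Rightarrow> 'a metric_field \<Rightarrow> bool" where
  "compatible_metric A D T g \<longleftrightarrow>
     (\<forall>c\<in>A. \<forall>p\<in>chart_dom c. \<forall>v. defining_form D T c p v = g c p (T c p) v)"

text \<open>\<open>sqrt (det g\<^sub>i\<^sub>j) dx\<^sub>1 \<and> dx\<^sub>2 \<and> dx\<^sub>3\<close>, for charts of an oriented atlas.\<close>

definition volume_form :: "'a metric_field \<Rightarrow> 'a form3" where
  "volume_form g c p u v w =
     sqrt (det (\<chi> i j. g c p (axis i 1) (axis j 1))) * det (vector [u, v, w] :: real^3^3)"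

text \<open>A connection is given by its coefficients \<open>\<Gamma>\<close>; \<open>cov_deriv \<Gamma> X Y\<close> is \<open>\<nabla>\<^sub>X Y\<close>.\<close>

type_synonym 'a conn = "'a chart \<Rightarrow> 'a \<Rightarrow> real^3 \<Rightarrow> real^3 \<Rightarrow> real^3"

definition cov_deriv :: "'a conn \<Rightarrow> 'a vfield \<Rightarrow> 'a vfield \<Rightarrow> 'a vfield" where
  "cov_deriv \<Gamma> X Y c p = chart_deriv c (Y c) p (X c p) + \<Gamma> c p (X c p) (Y c p)"

definition lie_bracket :: "'a vfield \<Rightarrow> 'a vfield \<Rightarrow> 'a vfield" where
  "lie_bracket X Y c p = chart_deriv c (Y c) p (X c p) - chart_deriv c (X c) p (Y c p)"

text \<open>The second clause contains the (inhomogeneous) transformation law and the smoothness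
  of \<open>\<Gamma>\<close>.\<close>

definition affine_connection :: "('a::topological_space) chart set \<Rightarrow> 'a conn \<Rightarrow> bool" where
  "affine_connection A \<Gamma> \<longleftrightarrow>
     (\<forall>c\<in>A. \<forall>p\<in>chart_dom c. bilinear (\<Gamma> c p)) \<and>
     (\<forall>W X Y. vector_field A W X \<and> vector_field A W Y \<longrightarrow> vector_field A W (cov_deriv \<Gamma> X Y))"

definition torsion_free :: "('a::topological_space) chart set \<Rightarrow> 'a conn \<Rightarrow> bool" where
  "torsion_free A \<Gamma> \<longleftrightarrow>
     (\<forall>W X Y. vector_field A W X \<and> vector_field A W Y \<longrightarrow>
        (\<forall>c\<in>A. \<forall>p\<in>W \<inter> chart_dom c.
           cov_deriv \<Gamma> X Y c p - cov_deriv \<Gamma> Y X c p = lie_bracket X Y c p))"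

definition metric_connection ::
    "('a::topological_space) chart set \<Rightarrow> 'a metric_field \<Rightarrow> 'a conn \<Rightarrow> bool" where
  "metric_connection A g \<Gamma> \<longleftrightarrow>
     (\<forall>W X Y Z. vector_field A W X \<and> vector_field A W Y \<and> vector_field A W Z \<longrightarrow>
        (\<forall>c\<in>A. \<forall>p\<in>W \<inter> chart_dom c.
           chart_deriv c (\<lambda>q. g c q (Y c q) (Z c q)) p (X c p) =
           g c p (cov_deriv \<Gamma> X Y c p) (Z c p) + g c p (Y c p) (cov_deriv \<Gamma> X Z c p)))"

definition levi_civita ::
    "('a::topological_space) chart set \<Rightarrow> 'a metric_field \<Rightarrow> 'a conn \<Rightarrow> bool" where
  "levi_civita A g \<Gamma> \<longleftrightarrow>
     affine_connection A \<Gamma> \<and> torsion_free A \<Gamma> \<and> metric_connection A g \<Gamma>"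


subsection \<open>Frenet frame of the \<open>T\<close>-curves and second fundamental form\<close>

text \<open>\<open>k\<close> is the curvature of the \<open>T\<close>-curves on all of the manifold, while \<open>N\<close>, \<open>B\<close>, \<open>\<tau>\<close> are
  constrained only on the open set where \<open>k \<noteq> 0\<close>. The determinant condition says that
  \<open>(T, N, B)\<close> is positively oriented.\<close>

definition frenet_apparatus ::
    "('a::topological_space) chart set \<Rightarrow> 'a metric_field \<Rightarrow> 'a conn \<Rightarrow> 'a vfield \<Rightarrow>
     ('a \<Rightarrow> real) \<Rightarrow> 'a vfield \<Rightarrow> 'a vfield \<Rightarrow> ('a \<Rightarrow> real) \<Rightarrow> bool" where
  "frenet_apparatus A g \<Gamma> T k N B \<tau> \<longleftrightarrow>
     (\<forall>c\<in>A. \<forall>p\<in>chart_dom c.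
        k p = sqrt (g c p (cov_deriv \<Gamma> T T c p) (cov_deriv \<Gamma> T T c p))) \<and>
     vector_field A {p. k p \<noteq> 0} N \<and> vector_field A {p. k p \<noteq> 0} B \<and>
     (\<forall>c\<in>A. \<forall>p\<in>chart_dom c. k p \<noteq> 0 \<longrightarrow>
        g c p (T c p) (T c p) = 1 \<and> g c p (N c p) (N c p) = 1 \<and> g c p (B c p) (B c p) = 1 \<and>
        g c p (T c p) (N c p) = 0 \<and> g c p (T c p) (B c p) = 0 \<and> g c p (N c p) (B c p) = 0 \<and>
        det (vector [T c p, N c p, B c p] :: real^3^3) > 0 \<and>
        cov_deriv \<Gamma> T T c p = k p *\<^sub>R N c p \<and>
        cov_deriv \<Gamma> T N c p = - k p *\<^sub>R T c p + \<tau> p *\<^sub>R B c p \<and>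
        cov_deriv \<Gamma> T B c p = - \<tau> p *\<^sub>R N c p)"

definition second_fund_form ::
    "'a metric_field \<Rightarrow> 'a conn \<Rightarrow> 'a vfield \<Rightarrow> 'a vfield \<Rightarrow> 'a vfield \<Rightarrow> 'a chart \<Rightarrow> 'a \<Rightarrow> real" where
  "second_fund_form g \<Gamma> T X Y c p = g c p (cov_deriv \<Gamma> X Y c p) (T c p)"

end

theory Submission
  imports Defs
begin

text \<open>
  The proof rests on the identity \<open>\<eta> = g(\<nabla>\<^sub>T T, \<cdot>)\<close>, valid on all of \<open>M\<close>. Compatibility says
  \<open>\<omega> = g(T, \<cdot>)\<close>, so \<open>g(T, T) = \<omega>(T) = 1\<close>. Evaluating \<open>d\<omega>(T, V)\<close> by the Cartan formula, with
  \<open>\<nabla>\<close> metric and torsion free, leaves \<open>g(\<nabla>\<^sub>T T, V) + g(T, \<nabla>\<^sub>V T)\<close>, and the last term is half the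
  derivative of the constant \<open>g(T, T)\<close> along \<open>V\<close> (\<open>eta_form_eq_curvature\<close>).

  Where \<open>k \<noteq> 0\<close> this reads \<open>\<eta> = k g(N, \<cdot>)\<close>. Since \<open>\<eta>\<close> kills both \<open>T\<close> and \<open>B\<close>, only one term of the
  wedge product survives on the Frenet frame, \<open>(\<eta> \<and> d\<eta>)(T, N, B) = k d\<eta>(B, T)\<close>, and the Cartan formula
  reduces it to \<open>- k \<eta>([B, T]) = - k\<^sup>2 g(N, \<nabla>\<^sub>B T - \<nabla>\<^sub>T B)\<close>; no derivative of \<open>k\<close> enters. Here
  \<open>g(N, \<nabla>\<^sub>T B) = - \<tau>\<close>, and differentiating \<open>g(N, T) = 0\<close> along \<open>B\<close> gives
  \<open>g(N, \<nabla>\<^sub>B T) = - h(B, N)\<close>. The frame is orthonormal and positive, so \<open>dV\<^sub>g\<close> takes the value 1 on it,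
  and two alternating 3-forms on a 3-dimensional space that agree on one basis agree
  (\<open>wedge_eta_form_eq\<close>).

  Where \<open>k = 0\<close>, the field \<open>\<nabla>\<^sub>T T\<close> and hence \<open>\<eta>\<close> vanish, so the two 3-forms of the integral formula are
  opposite at every point of every chart of the atlas. Their integrals are computed with a partition of
  unity picked by Hilbert choice; the values of the forms are controlled only in charts of the atlas, so one
  has to know that a partition of unity subordinate to the atlas exists. It is built from bump functions
  in the usual way (\<open>partition_of_unity_exists\<close>), with smoothness of all functions involved following
  from one closure argument (\<open>smooth_closure_partial\<close>).
\<close>

section \<open>Calculus in a chart\<close>

definition chart_differentiable ::
    "'a chart \<Rightarrow> ('a \<Rightarrow> 'b::real_normed_vector) \<Rightarrow> 'a \<Rightarrow> bool" where
  "chart_differentiable c f p \<longleftrightarrow> (f \<circ> chart_inv c) differentiable (at (chart_map c p))"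

lemma chart_inv_chart_map: "is_chart c \<Longrightarrow> p \<in> chart_dom c \<Longrightarrow> chart_inv c (chart_map c p) = p"
  by (auto simp: is_chart_def homeomorphism_def)

lemma chart_inv_mem: "x \<in> chart_map c ` V \<Longrightarrow> V \<subseteq> chart_dom c \<Longrightarrow> is_chart c \<Longrightarrow> chart_inv c x \<in> V"
  using chart_inv_chart_map[of c] by auto

lemma open_chart_image:
  assumes "is_chart c" "open W"
  shows "open (chart_map c ` (W \<inter> chart_dom c))"
proof -
  have h: "homeomorphism (chart_dom c) (chart_map c ` chart_dom c) (chart_map c) (chart_inv c)"
    and o: "open (chart_map c ` chart_dom c)"
    using assms by (auto simp: is_chart_def)
  have "openin (top_of_set (chart_map c ` chart_dom c)) (chart_map c ` (W \<inter> chart_dom c))"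
    using homeomorphism_imp_open_map[OF h, of "W \<inter> chart_dom c"] assms(2)
    by (metis openin_open_Int inf_commute)
  then show ?thesis
    using o by (metis openin_open_eq)
qed

lemma chart_deriv_works:
  "chart_differentiable c f p \<Longrightarrow>
     ((f \<circ> chart_inv c) has_derivative chart_deriv c f p) (at (chart_map c p))"
  unfolding chart_differentiable_def chart_deriv_def[abs_def]
  by (simp add: frechet_derivative_works[symmetric] eta_contract_eq)

lemma linear_chart_deriv: "chart_differentiable c f p \<Longrightarrow> linear (chart_deriv c f p)"
  by (rule has_derivative_linear[OF chart_deriv_works])

lemma chart_has_derivative_local:
  assumes "is_chart c" "open W" "p \<in> W \<inter> chart_dom c"
    and eq: "\<And>q. q \<in> W \<inter> chart_dom c \<Longrightarrow> f q = F q"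
    and der: "((\<lambda>x. F (chart_inv c x)) has_derivative f') (at (chart_map c p))"
  shows "((f \<circ> chart_inv c) has_derivative f') (at (chart_map c p))"
proof (rule has_derivative_transform_within_open[OF der open_chart_image[OF assms(1,2)]])
  show "chart_map c p \<in> chart_map c ` (W \<inter> chart_dom c)" using assms by auto
next
  fix x assume x: "x \<in> chart_map c ` (W \<inter> chart_dom c)"
  then obtain q where "x = chart_map c q" "q \<in> W \<inter> chart_dom c" by auto
  then show "F (chart_inv c x) = (f \<circ> chart_inv c) x"
    using eq[of q] chart_inv_chart_map[OF assms(1), of q] by auto
qed

lemma chart_deriv_eqI:
  assumes "((f \<circ> chart_inv c) has_derivative f') (at (chart_map c p))"
  shows "chart_deriv c f p = f'" "chart_differentiable c f p"
  using assms frechet_derivative_at[OF assms]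
  by (auto simp: chart_deriv_def[abs_def] chart_differentiable_def differentiable_def)

lemma chart_deriv_cong:
  assumes "is_chart c" "open W" "p \<in> W \<inter> chart_dom c"
    and "\<And>q. q \<in> W \<inter> chart_dom c \<Longrightarrow> f q = g q" "chart_differentiable c g p"
  shows "chart_deriv c f p = chart_deriv c g p" "chart_differentiable c f p"
proof -
  have "((\<lambda>x. g (chart_inv c x)) has_derivative chart_deriv c g p) (at (chart_map c p))"
    using chart_deriv_works[OF assms(5)] by (simp add: o_def)
  then have "((f \<circ> chart_inv c) has_derivative chart_deriv c g p) (at (chart_map c p))"
    by (intro chart_has_derivative_local[OF assms(1-4)])
  from chart_deriv_eqI[OF this]
  show "chart_deriv c f p = chart_deriv c g p" "chart_differentiable c f p" by -
qed

lemma chart_deriv_const: "chart_deriv c (\<lambda>q. a) p = (\<lambda>u. 0)" "chart_differentiable c (\<lambda>q. a) p"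
proof -
  have "((\<lambda>q. a) \<circ> chart_inv c has_derivative (\<lambda>u. 0)) (at (chart_map c p))"
    by (simp add: o_def)
  from chart_deriv_eqI[OF this]
  show "chart_deriv c (\<lambda>q. a) p = (\<lambda>u. 0)" "chart_differentiable c (\<lambda>q. a) p" by -
qed

lemma chart_deriv_locally_const:
  assumes "is_chart c" "open W" "p \<in> W \<inter> chart_dom c"
    and "\<And>q. q \<in> W \<inter> chart_dom c \<Longrightarrow> f q = a"
  shows "chart_deriv c f p = (\<lambda>u. 0)"
  by (rule trans[OF chart_deriv_cong(1)[OF assms chart_deriv_const(2)] chart_deriv_const(1)])

lemma smooth_imp_chart_differentiable:
  assumes "smooth_in_chart c W f" "p \<in> W \<inter> chart_dom c"
  shows "chart_differentiable c f p"
proof -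
  have "Ck_on (Suc 0) (chart_map c ` (W \<inter> chart_dom c)) (f \<circ> chart_inv c)"
    using assms by (simp add: smooth_in_chart_def Cinf_on_def del: Ck_on.simps)
  then show ?thesis using assms by (auto simp: chart_differentiable_def)
qed

lemma linear_expand_axis:
  fixes l :: "real^3 \<Rightarrow> 'b::real_vector"
  assumes "linear l"
  shows "l v = (\<Sum>i\<in>UNIV. v $ i *\<^sub>R l (axis i 1))"
proof -
  have "v = (\<Sum>i\<in>UNIV. v $ i *\<^sub>R axis i 1)"
    using basis_expansion[of v] by (simp add: scalar_mult_eq_scaleR)
  then have "l v = l (\<Sum>i\<in>UNIV. v $ i *\<^sub>R axis i 1)" by simp
  also have "\<dots> = (\<Sum>i\<in>UNIV. v $ i *\<^sub>R l (axis i 1))"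
    using assms by (simp add: linear_sum linear_cmul)
  finally show ?thesis .
qed

text \<open>Leibniz rule for the pairing of a 1-form with a vector field: the first term differentiates
  the form with the vector frozen, the second differentiates the components of the field.\<close>

lemma pairing_derivative:
  fixes \<alpha> :: "'a::topological_space \<Rightarrow> real^3 \<Rightarrow> real"
  assumes "is_chart c" "open W" "p \<in> W \<inter> chart_dom c"
    and lin: "\<And>q. q \<in> W \<inter> chart_dom c \<Longrightarrow> linear (\<alpha> q)"
    and d\<alpha>: "\<And>v. chart_differentiable c (\<lambda>q. \<alpha> q v) p"
    and dY: "chart_differentiable c Y p"
  shows "chart_deriv c (\<lambda>q. \<alpha> q (Y q)) p u
      = chart_deriv c (\<lambda>q. \<alpha> q (Y p)) p u + \<alpha> p (chart_deriv c Y p u)"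
    and "chart_differentiable c (\<lambda>q. \<alpha> q (Y q)) p"
proof -
  have ip: "chart_inv c (chart_map c p) = p"
    using assms chart_inv_chart_map by blast
  have dA: "((\<lambda>x. \<alpha> (chart_inv c x) (axis i 1)) has_derivative
      chart_deriv c (\<lambda>q. \<alpha> q (axis i 1)) p) (at (chart_map c p))" for i
    using chart_deriv_works[OF d\<alpha>] by (simp add: o_def)
  have dYi: "((\<lambda>x. Y (chart_inv c x) $ i) has_derivative
      (\<lambda>u. chart_deriv c Y p u $ i)) (at (chart_map c p))" for i
    using bounded_linear.has_derivative[OF bounded_linear_vec_nth chart_deriv_works[OF dY]]
    by (simp add: o_def)
  have 1: "(((\<lambda>q. \<alpha> q (Y q)) \<circ> chart_inv c) has_derivative
      (\<lambda>u. \<Sum>i\<in>UNIV. Y p $ i * chart_deriv c (\<lambda>q. \<alpha> q (axis i 1)) p u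
        + chart_deriv c Y p u $ i * \<alpha> p (axis i 1))) (at (chart_map c p))"
  proof (rule chart_has_derivative_local[OF assms(1-3),
        where F = "\<lambda>q. \<Sum>i\<in>UNIV. Y q $ i * \<alpha> q (axis i 1)"])
    fix q assume "q \<in> W \<inter> chart_dom c"
    then show "\<alpha> q (Y q) = (\<Sum>i\<in>UNIV. Y q $ i * \<alpha> q (axis i 1))"
      using linear_expand_axis[OF lin, of q "Y q"] by simp
  next
    show "((\<lambda>x. \<Sum>i\<in>UNIV. Y (chart_inv c x) $ i * \<alpha> (chart_inv c x) (axis i 1)) has_derivative
      (\<lambda>u. \<Sum>i\<in>UNIV. Y p $ i * chart_deriv c (\<lambda>q. \<alpha> q (axis i 1)) p u
        + chart_deriv c Y p u $ i * \<alpha> p (axis i 1))) (at (chart_map c p))"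
      by (rule has_derivative_sum) (use has_derivative_mult[OF dYi dA] ip in simp)
  qed
  have 2: "(((\<lambda>q. \<alpha> q (Y p)) \<circ> chart_inv c) has_derivative
      (\<lambda>u. \<Sum>i\<in>UNIV. Y p $ i * chart_deriv c (\<lambda>q. \<alpha> q (axis i 1)) p u)) (at (chart_map c p))"
  proof (rule chart_has_derivative_local[OF assms(1-3),
        where F = "\<lambda>q. \<Sum>i\<in>UNIV. Y p $ i * \<alpha> q (axis i 1)"])
    fix q assume "q \<in> W \<inter> chart_dom c"
    then show "\<alpha> q (Y p) = (\<Sum>i\<in>UNIV. Y p $ i * \<alpha> q (axis i 1))"
      using linear_expand_axis[OF lin, of q "Y p"] by simp
  next
    show "((\<lambda>x. \<Sum>i\<in>UNIV. Y p $ i * \<alpha> (chart_inv c x) (axis i 1)) has_derivative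
      (\<lambda>u. \<Sum>i\<in>UNIV. Y p $ i * chart_deriv c (\<lambda>q. \<alpha> q (axis i 1)) p u)) (at (chart_map c p))"
      by (intro has_derivative_sum has_derivative_mult_right dA)
  qed
  show "chart_differentiable c (\<lambda>q. \<alpha> q (Y q)) p" using chart_deriv_eqI[OF 1] by simp
  show "chart_deriv c (\<lambda>q. \<alpha> q (Y q)) p u
      = chart_deriv c (\<lambda>q. \<alpha> q (Y p)) p u + \<alpha> p (chart_deriv c Y p u)"
    using linear_expand_axis[OF lin[OF assms(3)], of "chart_deriv c Y p u"]
    by (simp add: chart_deriv_eqI(1)[OF 1] chart_deriv_eqI(1)[OF 2] sum.distrib)
qed

section \<open>Exterior derivative, wedge product and volume form\<close>

text \<open>The Cartan formula for vector fields with variable components: the Leibniz terms that contain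
  derivatives of the components of \<open>X\<close> and \<open>Y\<close> combine to the Lie bracket.\<close>

lemma ext_deriv_fields:
  assumes "is_chart c" "open W" "p \<in> W \<inter> chart_dom c"
    and "\<And>q. q \<in> W \<inter> chart_dom c \<Longrightarrow> linear (\<alpha> c q)"
    and "\<And>v. chart_differentiable c (\<lambda>q. \<alpha> c q v) p"
    and "chart_differentiable c (X c) p" "chart_differentiable c (Y c) p"
  shows "ext_deriv \<alpha> c p (X c p) (Y c p) =
      chart_deriv c (\<lambda>q. \<alpha> c q (Y c q)) p (X c p) - chart_deriv c (\<lambda>q. \<alpha> c q (X c q)) p (Y c p)
      - \<alpha> c p (lie_bracket X Y c p)"
  using pairing_derivative(1)[OF assms(1-5) assms(6), of "Y c p"]
    pairing_derivative(1)[OF assms(1-5) assms(7), of "X c p"] linear_diff[OF assms(4)[OF assms(3)]]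
  by (simp add: ext_deriv_def lie_bracket_def)

lemma ext_deriv_skew: "ext_deriv \<alpha> c p v u = - ext_deriv \<alpha> c p u v"
  by (simp add: ext_deriv_def)

lemma linear_ext_deriv:
  assumes "is_chart c" "open W" "p \<in> W \<inter> chart_dom c"
    and lin: "\<And>q. q \<in> W \<inter> chart_dom c \<Longrightarrow> linear (\<alpha> c q)"
    and d\<alpha>: "\<And>v. chart_differentiable c (\<lambda>q. \<alpha> c q v) p"
  shows "linear (ext_deriv \<alpha> c p u)"
proof -
  have dA: "((\<lambda>x. \<alpha> c (chart_inv c x) v) has_derivative
      chart_deriv c (\<lambda>q. \<alpha> c q v) p) (at (chart_map c p))" for v
    using chart_deriv_works[OF d\<alpha>] by (simp add: o_def)
  have add: "chart_deriv c (\<lambda>q. \<alpha> c q (v + w)) p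
      = (\<lambda>u. chart_deriv c (\<lambda>q. \<alpha> c q v) p u + chart_deriv c (\<lambda>q. \<alpha> c q w) p u)" for v w
    by (rule chart_deriv_eqI(1), rule chart_has_derivative_local[OF assms(1-3),
        where F = "\<lambda>q. \<alpha> c q v + \<alpha> c q w"])
      (auto simp: linear_add[OF lin] intro!: has_derivative_add dA)
  have scale: "chart_deriv c (\<lambda>q. \<alpha> c q (r *\<^sub>R v)) p
      = (\<lambda>u. r * chart_deriv c (\<lambda>q. \<alpha> c q v) p u)" for r v
    by (rule chart_deriv_eqI(1), rule chart_has_derivative_local[OF assms(1-3),
        where F = "\<lambda>q. r * \<alpha> c q v"])
      (auto simp: linear_cmul[OF lin] intro!: has_derivative_mult_right dA)
  show ?thesis
  proof (rule linearI)
    fix v w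
    have "chart_deriv c (\<lambda>q. \<alpha> c q u) p (v + w)
        = chart_deriv c (\<lambda>q. \<alpha> c q u) p v + chart_deriv c (\<lambda>q. \<alpha> c q u) p w"
      by (rule linear_add[OF linear_chart_deriv[OF d\<alpha>]])
    then show "ext_deriv \<alpha> c p u (v + w) = ext_deriv \<alpha> c p u v + ext_deriv \<alpha> c p u w"
      unfolding ext_deriv_def add by linarith
  next
    fix r v
    have "chart_deriv c (\<lambda>q. \<alpha> c q u) p (r *\<^sub>R v) = r *\<^sub>R chart_deriv c (\<lambda>q. \<alpha> c q u) p v"
      by (rule linear_cmul[OF linear_chart_deriv[OF d\<alpha>]])
    then show "ext_deriv \<alpha> c p u (r *\<^sub>R v) = r *\<^sub>R ext_deriv \<alpha> c p u v"
      unfolding ext_deriv_def scale by (simp add: right_diff_distrib)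
  qed
qed

text \<open>The wedge product is alternating and trilinear, hence a multiple of the determinant.\<close>

lemma wedge_eq_det:
  assumes lin: "linear (\<alpha> c p)" and lin2: "\<And>u. linear (\<beta> c p u)"
    and skew: "\<And>u v. \<beta> c p v u = - \<beta> c p u v"
  shows "wedge \<alpha> \<beta> c p u v w
      = det (vector [u, v, w] :: real^3^3) * wedge \<alpha> \<beta> c p (axis 1 1) (axis 2 1) (axis 3 1)"
proof -
  define e :: "3 \<Rightarrow> real^3" where "e = (\<lambda>i. axis i 1)"
  have a: "\<alpha> c p u = u $ 1 * \<alpha> c p (e 1) + u $ 2 * \<alpha> c p (e 2) + u $ 3 * \<alpha> c p (e 3)" for u
    using linear_expand_axis[OF lin, of u] by (simp add: sum_3 e_def)
  have r: "\<beta> c p u v = v $ 1 * \<beta> c p u (e 1) + v $ 2 * \<beta> c p u (e 2) + v $ 3 * \<beta> c p u (e 3)" for u v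
    using linear_expand_axis[OF lin2, of u v] by (simp add: sum_3 e_def)
  have l: "\<beta> c p u v = u $ 1 * \<beta> c p (e 1) v + u $ 2 * \<beta> c p (e 2) v + u $ 3 * \<beta> c p (e 3) v" for u v
    using r[of v u] skew[of u v] skew[of "e 1" v] skew[of "e 2" v] skew[of "e 3" v] by simp
  have z: "\<beta> c p (e i) (e i) = 0" for i
    using skew[of "e i" "e i"] by simp
  have b: "\<beta> c p u v = (u $ 1 * v $ 2 - u $ 2 * v $ 1) * \<beta> c p (e 1) (e 2)
      + (u $ 2 * v $ 3 - u $ 3 * v $ 2) * \<beta> c p (e 2) (e 3)
      + (u $ 3 * v $ 1 - u $ 1 * v $ 3) * \<beta> c p (e 3) (e 1)" for u v
    using l[of u v] r[of "e 1" v] r[of "e 2" v] r[of "e 3" v] z[of 1] z[of 2] z[of 3]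
      skew[of "e 2" "e 1"] skew[of "e 3" "e 2"] skew[of "e 1" "e 3"]
    by (simp add: algebra_simps)
  show ?thesis
    unfolding wedge_def det_3 fun_cong[OF e_def[symmetric]]
    by (simp add: a[of u] a[of v] a[of w] b[of u v] b[of v w] b[of w u] vector_3 algebra_simps)
qed

text \<open>The Gram matrix \<open>G\<close> of the coordinate vectors and the matrix \<open>M\<close> of an orthonormal frame
  satisfy \<open>M G M\<^sup>T = 1\<close>, so \<open>sqrt (det G)\<close> is the reciprocal of \<open>det M\<close>.\<close>

lemma volume_form_orthonormal_frame:
  assumes bil: "bilinear (g c p)" and sym: "\<And>u v. g c p u v = g c p v u"
    and "g c p a a = 1" "g c p b b = 1" "g c p d d = 1"
    and "g c p a b = 0" "g c p a d = 0" "g c p b d = 0"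
    and pos: "det (vector [a, b, d] :: real^3^3) > 0"
  shows "volume_form g c p a b d = 1"
proof -
  define M where "M = (vector [a, b, d] :: real^3^3)"
  define G where "G = ((\<chi> i j. g c p (axis i 1) (axis j 1)) :: real^3^3)"
  have linl: "linear (\<lambda>u. g c p u v)" and linr: "linear (g c p u)" for u v
    using bil by (auto simp: bilinear_def)
  have ex: "g c p u v = (\<Sum>i\<in>UNIV. \<Sum>j\<in>UNIV. u $ i * (G $ i $ j) * v $ j)" for u v
  proof -
    have "g c p u v = (\<Sum>i\<in>UNIV. u $ i * g c p (axis i 1) v)"
      using linear_expand_axis[OF linl, of u v] by simp
    also have "\<dots> = (\<Sum>i\<in>UNIV. u $ i * (\<Sum>j\<in>UNIV. v $ j * g c p (axis i 1) (axis j 1)))"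
      using linear_expand_axis[OF linr, of _ v] by simp
    finally show ?thesis by (simp add: G_def sum_distrib_left mult.assoc mult.commute mult.left_commute)
  qed
  have row: "(M ** G ** transpose M) $ i $ j = g c p (M $ i) (M $ j)" for i j
    unfolding ex matrix_matrix_mult_def transpose_def
    by (simp add: sum_distrib_right, subst sum.swap, simp)
  have "M ** G ** transpose M = mat 1"
    using assms sym[of b a] sym[of d a] sym[of d b]
    by (simp add: vec_eq_iff forall_3 row mat_def) (simp add: M_def vector_3)
  then have "det M * det G * det M = 1"
    by (metis det_mul det_transpose det_I)
  moreover have "det M > 0" using pos by (simp add: M_def)
  ultimately have "det G = (1 / det M)\<^sup>2" by (simp add: field_simps power2_eq_square)
  then have "sqrt (det G) = 1 / det M" using \<open>det M > 0\<close> by simp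
  then show ?thesis using \<open>det M > 0\<close> by (simp add: volume_form_def M_def G_def)
qed

section \<open>Fields adapted to the plane field\<close>

text \<open>A plane in \<open>\<real>\<^sup>3\<close> is the orthogonal complement of some vector \<open>a\<close>, and \<open>(a \<bullet> v) / (a \<bullet> T)\<close> is the
  required functional; the decomposition \<open>v = (v - l(v) T) + l(v) T\<close> shows that it is the only one.\<close>

lemma defining_form_spec:
  assumes "subspace (D c p)" "dim (D c p) = 2" "T c p \<notin> D c p"
  shows "linear (defining_form D T c p)" "{v. defining_form D T c p v = 0} = D c p"
    "defining_form D T c p (T c p) = 1"
proof -
  let ?P = "\<lambda>l. linear l \<and> {v. l v = 0} = D c p \<and> l (T c p) = (1::real)"
  have "dim (D c p) < DIM(real^3)" using assms by simp
  then obtain a where a: "a \<noteq> 0" "span (D c p) \<subseteq> {x. a \<bullet> x = 0}"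
    using lowdim_subset_hyperplane by blast
  have "D c p = {x. a \<bullet> x = 0}"
  proof (rule subspace_dim_equal[OF assms(1) subspace_hyperplane])
    show "D c p \<subseteq> {x. a \<bullet> x = 0}" using a span_superset by blast
    show "dim {x. a \<bullet> x = 0} \<le> dim (D c p)" using dim_hyperplane[OF a(1)] assms by simp
  qed
  then have D: "D c p = {x. a \<bullet> x = 0}" and nz: "a \<bullet> T c p \<noteq> 0" using assms(3) by auto
  have "linear (\<lambda>v. (a \<bullet> v) / (a \<bullet> T c p))"
    by (rule linearI) (simp_all add: inner_add_right add_divide_distrib)
  then have "?P (\<lambda>v. (a \<bullet> v) / (a \<bullet> T c p))"
    using nz by (simp add: D)
  moreover have "l = l'" if l: "?P l" and l': "?P l'" for l l'
  proof
    fix v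
    have "l (v - l v *\<^sub>R T c p) = 0"
      using l by (simp add: linear_diff linear_cmul)
    then have "l' (v - l v *\<^sub>R T c p) = 0" using l l' by blast
    then show "l v = l' v" using l' by (simp add: linear_diff linear_cmul)
  qed
  ultimately have "\<exists>!l. ?P l" by blast
  from theI'[OF this] show "linear (defining_form D T c p)"
    "{v. defining_form D T c p v = 0} = D c p" "defining_form D T c p (T c p) = 1"
    unfolding defining_form_def by blast+
qed

lemma Ck_on_subset: "Ck_on n S f \<Longrightarrow> S' \<subseteq> S \<Longrightarrow> Ck_on n S' f"
  by (induction n arbitrary: f) (auto intro: continuous_on_subset)

lemma vector_field_subset:
  fixes X :: "('a::topological_space) vfield"
  assumes "vector_field A W X" "open V" "V \<subseteq> W"
  shows "vector_field A V X"
proof -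
  have "chart_map c ` (V \<inter> chart_dom c) \<subseteq> chart_map c ` (W \<inter> chart_dom c)" for c :: "'a chart"
    using assms(3) by auto
  then have "smooth_in_chart c V (X c)" if "smooth_in_chart c W (X c)" for c
    using that Ck_on_subset unfolding smooth_in_chart_def Cinf_on_def by metis
  moreover have "\<forall>c\<in>A. smooth_in_chart c W (X c)" and
    "\<And>c c' p. c \<in> A \<Longrightarrow> c' \<in> A \<Longrightarrow> p \<in> W \<inter> chart_dom c \<inter> chart_dom c' \<Longrightarrow>
        X c' p = chart_deriv c (chart_map c') p (X c p)"
    using assms(1) by (simp_all add: vector_field_def del: Int_iff)
  moreover have "p \<in> W \<inter> chart_dom c \<inter> chart_dom c'" if "p \<in> V \<inter> chart_dom c \<inter> chart_dom c'" for p c c'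
    using that assms(3) by blast
  ultimately show ?thesis
    using assms(2) unfolding vector_field_def by metis
qed

lemma vector_field_differentiable:
  "vector_field A W X \<Longrightarrow> c \<in> A \<Longrightarrow> p \<in> W \<inter> chart_dom c \<Longrightarrow> chart_differentiable c (X c) p"
  by (rule smooth_imp_chart_differentiable[of c W]) (simp_all only: vector_field_def)

text \<open>The axioms of the connection speak of smooth vector fields only, while forms are evaluated on
  vectors. A local frame of \<open>D\<close> completed by \<open>T\<close> provides enough fields to test an identity that is
  linear in a vector, so that no field has to be extended from one chart to the others.\<close>

lemma eq_on_adapted_frame:
  assumes "plane_field A D" "transverse A D T" "vector_field A UNIV T" "c \<in> A" "p \<in> chart_dom c"
    and "linear l" "linear l'"
    and fld: "\<And>W V. vector_field A W V \<Longrightarrow> p \<in> W \<Longrightarrow> l (V c p) = l' (V c p)"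
  shows "l v = l' v"
proof -
  have "\<exists>W X Y. p \<in> W \<and> vector_field A W X \<and> vector_field A W Y \<and>
        (\<forall>c\<in>A. \<forall>q\<in>W \<inter> chart_dom c. D c q = span {X c q, Y c q})"
    using assms(1)[unfolded plane_field_def, THEN conjunct2, THEN conjunct2] by (rule spec)
  then obtain W X Y where W: "p \<in> W" "vector_field A W X" "vector_field A W Y"
    and "\<forall>c\<in>A. \<forall>q\<in>W \<inter> chart_dom c. D c q = span {X c q, Y c q}"
    by (elim exE conjE)
  then have Dp: "D c p = span {X c p, Y c p}" using assms(4,5) by simp
  have "dim (D c p) = 2"
    using assms(1)[unfolded plane_field_def, THEN conjunct1] assms(4,5) by simp
  moreover have "T c p \<notin> D c p"
    using assms(2,4,5) by (simp add: transverse_def)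
  ultimately have "dim {T c p, X c p, Y c p} = DIM(real^3)"
    using dim_insert[of "T c p" "{X c p, Y c p}"] Dp by simp
  then have "span {T c p, X c p, Y c p} = UNIV" using dim_eq_full by blast
  moreover have "l b = l' b" if "b \<in> {T c p, X c p, Y c p}" for b
    using that fld[OF W(2,1)] fld[OF W(3,1)] fld[OF assms(3)] by blast
  ultimately show ?thesis
    using linear_eq_on_span[OF assms(6,7), of "{T c p, X c p, Y c p}" v] by blast
qed

section \<open>The Godbillon-Vey form pointwise\<close>

lemma riemannian_metric_at:
  assumes "riemannian_metric A g" "c \<in> A" "p \<in> chart_dom c"
  shows "bilinear (g c p)" "g c p u v = g c p v u" "linear (g c p u)" "linear (\<lambda>u. g c p u v)"
    "chart_differentiable c (\<lambda>q. g c q u v) p"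
proof -
  show "bilinear (g c p)" "g c p u v = g c p v u"
    using assms(1)[unfolded riemannian_metric_def, THEN conjunct1] assms(2,3) by blast+
  then show "linear (g c p u)" "linear (\<lambda>u. g c p u v)"
    by (simp_all add: bilinear_def)
  have "smooth_in_chart c UNIV (\<lambda>q. g c q u v)"
    using assms(1)[unfolded riemannian_metric_def, THEN conjunct2, THEN conjunct1] assms(2) by blast
  then show "chart_differentiable c (\<lambda>q. g c q u v) p"
    by (rule smooth_imp_chart_differentiable) (use assms(3) in simp)
qed

lemma metric_dual_differentiable:
  assumes "riemannian_metric A g" "is_chart c" "c \<in> A" "open W" "p \<in> W \<inter> chart_dom c"
    and "chart_differentiable c Z p"
  shows "chart_differentiable c (\<lambda>q. g c q (Z q) v) p"
  by (rule pairing_derivative(2)[OF assms(2,4,5) _ _ assms(6), where \<alpha> = "\<lambda>q u. g c q u v"])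
    (use assms(5) in \<open>simp_all add: riemannian_metric_at(4,5)[OF assms(1,3)]\<close>)

lemma levi_civita_rules:
  assumes "levi_civita A g \<Gamma>" "vector_field A W X" "vector_field A W Y"
  shows "vector_field A W (cov_deriv \<Gamma> X Y)"
    and "c \<in> A \<Longrightarrow> p \<in> W \<inter> chart_dom c \<Longrightarrow>
      lie_bracket X Y c p = cov_deriv \<Gamma> X Y c p - cov_deriv \<Gamma> Y X c p"
    and "vector_field A W Z \<Longrightarrow> c \<in> A \<Longrightarrow> p \<in> W \<inter> chart_dom c \<Longrightarrow>
      chart_deriv c (\<lambda>q. g c q (Y c q) (Z c q)) p (X c p) =
      g c p (cov_deriv \<Gamma> X Y c p) (Z c p) + g c p (Y c p) (cov_deriv \<Gamma> X Z c p)"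
proof -
  show "vector_field A W (cov_deriv \<Gamma> X Y)"
    using assms(1)[unfolded levi_civita_def affine_connection_def] assms(2,3) by metis
  show "c \<in> A \<Longrightarrow> p \<in> W \<inter> chart_dom c \<Longrightarrow>
      lie_bracket X Y c p = cov_deriv \<Gamma> X Y c p - cov_deriv \<Gamma> Y X c p"
    using assms(1)[unfolded levi_civita_def torsion_free_def] assms(2,3) by metis
  show "vector_field A W Z \<Longrightarrow> c \<in> A \<Longrightarrow> p \<in> W \<inter> chart_dom c \<Longrightarrow>
      chart_deriv c (\<lambda>q. g c q (Y c q) (Z c q)) p (X c p) =
      g c p (cov_deriv \<Gamma> X Y c p) (Z c p) + g c p (Y c p) (cov_deriv \<Gamma> X Z c p)"
    by (rule assms(1)[unfolded levi_civita_def metric_connection_def,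
        THEN conjunct2, THEN conjunct2, rule_format, of W]) (simp_all add: assms(2,3))
qed

text \<open>For a vector field \<open>V\<close>, the Cartan formula gives
  \<open>d\<omega>(T, V) = T(g(T, V)) - V(1) - g(T, [T, V])\<close>. The term \<open>g(T, \<nabla>\<^sub>T V)\<close> occurs in the first summand and in
  the last and cancels, and \<open>g(T, \<nabla>\<^sub>V T) = 0\<close> because \<open>T\<close> has unit length.\<close>

lemma eta_form_eq_curvature:
  assumes at: "oriented_atlas A" and pl: "plane_field A D" and T: "vector_field A UNIV T"
    and tr: "transverse A D T" and g: "riemannian_metric A g"
    and co: "compatible_metric A D T g" and lc: "levi_civita A g \<Gamma>"
    and c: "c \<in> A" and p: "p \<in> chart_dom c"
  shows "eta_form D T c p v = g c p (cov_deriv \<Gamma> T T c p) v"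
proof -
  define \<omega> where "\<omega> = defining_form D T"
  have ch: "is_chart c" using at c unfolding oriented_atlas_def by blast
  have \<omega>: "\<omega> c q u = g c q (T c q) u" if "q \<in> chart_dom c" for q u
    using co c that unfolding compatible_metric_def \<omega>_def by blast
  have \<omega>T: "\<omega> c q (T c q) = 1" if q: "q \<in> chart_dom c" for q
    unfolding \<omega>_def
  proof (rule defining_form_spec(3))
    show "subspace (D c q)" "dim (D c q) = 2" "T c q \<notin> D c q"
      using pl[unfolded plane_field_def, THEN conjunct1] tr[unfolded transverse_def] c q by blast+
  qed
  have pU: "p \<in> UNIV \<inter> chart_dom c" using p by simp
  have dT: "chart_differentiable c (T c) p"
    using vector_field_differentiable[OF T c pU] .
  have lin: "linear (\<omega> c q)" if "q \<in> chart_dom c" for q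
    using \<omega>[OF that] riemannian_metric_at(3)[OF g c that] by presburger
  have d\<omega>: "chart_differentiable c (\<lambda>q. \<omega> c q u) p" for u
    by (rule chart_deriv_cong(2)[OF ch open_UNIV pU _ metric_dual_differentiable[OF g ch c open_UNIV pU dT]])
      (simp add: \<omega>)
  have "linear (ext_deriv \<omega> c p (T c p))"
    by (rule linear_ext_deriv[OF ch open_UNIV pU]) (simp_all add: lin d\<omega>)
  moreover have "linear (g c p (cov_deriv \<Gamma> T T c p))" using riemannian_metric_at(3)[OF g c p] .
  moreover have "ext_deriv \<omega> c p (T c p) (V c p) = g c p (cov_deriv \<Gamma> T T c p) (V c p)"
    if V: "vector_field A W V" and "p \<in> W" for W V
  proof -
    have W: "open W" and pW: "p \<in> W \<inter> chart_dom c"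
      using V that(2) p by (simp_all add: vector_field_def)
    have TW: "vector_field A W T" using vector_field_subset[OF T W] by simp
    have dV: "chart_differentiable c (V c) p"
      using vector_field_differentiable[OF V c pW] .
    have lin': "q \<in> W \<inter> chart_dom c \<Longrightarrow> linear (\<omega> c q)" for q using lin by simp
    have TV: "chart_deriv c (\<lambda>q. \<omega> c q (V c q)) p (T c p)
        = g c p (cov_deriv \<Gamma> T T c p) (V c p) + g c p (T c p) (cov_deriv \<Gamma> T V c p)"
    proof -
      have "chart_deriv c (\<lambda>q. g c q (T c q) (V c q)) p = chart_deriv c (\<lambda>q. \<omega> c q (V c q)) p"
        by (rule chart_deriv_cong(1)[OF ch W pW _ pairing_derivative(2)[OF ch W pW lin' d\<omega> dV]])
          (simp_all add: \<omega>)
      then show ?thesis using levi_civita_rules(3)[OF lc TW TW V c pW] by simp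
    qed
    have VT: "chart_deriv c (\<lambda>q. \<omega> c q (T c q)) p = (\<lambda>u. 0)"
      and VT': "chart_deriv c (\<lambda>q. g c q (T c q) (T c q)) p = (\<lambda>u. 0)"
      by (rule chart_deriv_locally_const[OF ch W pW, of _ 1]; use \<omega> \<omega>T in force)+
    have "g c p (T c p) (cov_deriv \<Gamma> V T c p) = 0"
      using levi_civita_rules(3)[OF lc V TW TW c pW] VT'
        riemannian_metric_at(2)[OF g c p, of "T c p" "cov_deriv \<Gamma> V T c p"] by simp
    then have "\<omega> c p (lie_bracket T V c p) = g c p (T c p) (cov_deriv \<Gamma> T V c p)"
      using linear_diff[OF riemannian_metric_at(3)[OF g c p]]
      by (simp add: levi_civita_rules(2)[OF lc TW V c pW] \<omega>[OF p])
    then show ?thesis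
      using ext_deriv_fields[where X = T and Y = V, OF ch W pW, of \<omega>] lin' d\<omega> dT dV
      by (simp add: TV VT)
  qed
  ultimately have "ext_deriv \<omega> c p (T c p) v = g c p (cov_deriv \<Gamma> T T c p) v"
    using eq_on_adapted_frame[OF pl tr T c p] by blast
  then show ?thesis by (simp add: eta_form_def contract_def \<omega>_def)
qed

text \<open>Both sides are multiples of the determinant, so it is enough to compare them on \<open>(T, N, B)\<close>, where
  \<open>\<eta>(T) = \<eta>(B) = 0\<close> and \<open>\<eta>(N) = k\<close>. These identities hold on an open set, which is what allows
  differentiating them.\<close>

lemma wedge_eta_form_eq:
  assumes at: "oriented_atlas A" and pl: "plane_field A D" and T: "vector_field A UNIV T"
    and tr: "transverse A D T" and g: "riemannian_metric A g"
    and co: "compatible_metric A D T g" and lc: "levi_civita A g \<Gamma>"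
    and fr: "frenet_apparatus A g \<Gamma> T k N B \<tau>"
    and c: "c \<in> A" and p: "p \<in> chart_dom c" and k: "k p \<noteq> 0"
  shows "wedge (eta_form D T) (ext_deriv (eta_form D T)) c p u v w =
      - (k p)\<^sup>2 * (\<tau> p - second_fund_form g \<Gamma> T B N c p) * volume_form g c p u v w"
proof -
  define \<eta> where "\<eta> = eta_form D T"
  let ?U = "{p. k p \<noteq> 0}"
  have ch: "is_chart c" using at c unfolding oriented_atlas_def by blast
  have N: "vector_field A ?U N" and B: "vector_field A ?U B"
    using fr by (simp_all add: frenet_apparatus_def)
  have U: "open ?U" using N unfolding vector_field_def by blast
  have pU: "p \<in> ?U \<inter> chart_dom c" using p k by simp
  have TU: "vector_field A ?U T" using vector_field_subset[OF T U] by simp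
  have frame: "g c q (T c q) (T c q) = 1 \<and> g c q (N c q) (N c q) = 1 \<and> g c q (B c q) (B c q) = 1 \<and>
        g c q (T c q) (N c q) = 0 \<and> g c q (T c q) (B c q) = 0 \<and> g c q (N c q) (B c q) = 0 \<and>
        det (vector [T c q, N c q, B c q] :: real^3^3) > 0 \<and>
        cov_deriv \<Gamma> T T c q = k q *\<^sub>R N c q \<and>
        cov_deriv \<Gamma> T B c q = - \<tau> q *\<^sub>R N c q" if "q \<in> ?U \<inter> chart_dom c" for q
    using fr[unfolded frenet_apparatus_def, THEN conjunct2, THEN conjunct2, THEN conjunct2] c that
    by simp
  note m = riemannian_metric_at[OF g c]
  have \<eta>g: "\<eta> c q = g c q (cov_deriv \<Gamma> T T c q)" if "q \<in> chart_dom c" for q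
    using eta_form_eq_curvature[OF at pl T tr g co lc c that] by (auto simp: \<eta>_def)
  have \<eta>: "\<eta> c q u = k q * g c q (N c q) u" if "q \<in> ?U \<inter> chart_dom c" for q u
    using frame[OF that] linear_cmul[OF m(4)] that by (simp add: \<eta>g)
  have lin: "linear (\<eta> c q)" if "q \<in> ?U \<inter> chart_dom c" for q
    using that m(3) by (simp add: \<eta>g)
  have pall: "p \<in> UNIV \<inter> chart_dom c" using p by simp
  have "chart_differentiable c (cov_deriv \<Gamma> T T c) p"
    by (rule vector_field_differentiable[OF levi_civita_rules(1)[OF lc T T] c pall])
  note dg = metric_dual_differentiable[OF g ch c open_UNIV pall this]
  have d\<eta>: "chart_differentiable c (\<lambda>q. \<eta> c q u) p" for u
    by (rule chart_deriv_cong(2)[OF ch open_UNIV pall _ dg]) (simp add: \<eta>g)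
  note dT = vector_field_differentiable[OF TU c pU]
  note dB = vector_field_differentiable[OF B c pU]

  have "\<eta> c q (T c q) = 0" "\<eta> c q (B c q) = 0" "g c q (N c q) (T c q) = 0"
    if q: "q \<in> ?U \<inter> chart_dom c" for q
    using frame[OF q] m(2)[of q "N c q" "T c q"] q by (auto simp: \<eta>)
  note zero = this
  have "chart_deriv c (\<lambda>q. \<eta> c q (T c q)) p = (\<lambda>u. 0)"
    "chart_deriv c (\<lambda>q. \<eta> c q (B c q)) p = (\<lambda>u. 0)"
    "chart_deriv c (\<lambda>q. g c q (N c q) (T c q)) p = (\<lambda>u. 0)"
    by (rule chart_deriv_locally_const[OF ch U pU, of _ 0], erule zero)+
  note der = this
  have h: "second_fund_form g \<Gamma> T B N c p = - g c p (N c p) (cov_deriv \<Gamma> B T c p)"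
    using levi_civita_rules(3)[OF lc B N TU c pU] der(3) by (simp add: second_fund_form_def)
  have "\<eta> c p (lie_bracket B T c p)
      = k p * (g c p (N c p) (cov_deriv \<Gamma> B T c p) + \<tau> p * g c p (N c p) (N c p))"
    using linear_add[OF m(3)[OF p]] linear_cmul[OF m(3)[OF p]] frame[OF pU]
    by (simp add: levi_civita_rules(2)[OF lc B TU c pU] \<eta>[OF pU])
  then have d\<eta>BT: "ext_deriv \<eta> c p (B c p) (T c p) = - k p * (\<tau> p - second_fund_form g \<Gamma> T B N c p)"
    using ext_deriv_fields[where X = B and Y = T, OF ch U pU, of \<eta>] lin d\<eta> dB dT frame[OF pU]
    by (simp add: der h)
  have frame_value: "wedge \<eta> (ext_deriv \<eta>) c p (T c p) (N c p) (B c p)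
      = - (k p)\<^sup>2 * (\<tau> p - second_fund_form g \<Gamma> T B N c p)"
    using zero[OF pU] frame[OF pU] by (simp add: wedge_def d\<eta>BT \<eta>[OF pU] power2_eq_square)

  have det: "wedge \<eta> (ext_deriv \<eta>) c p u v w = det (vector [u, v, w] :: real^3^3)
      * wedge \<eta> (ext_deriv \<eta>) c p (axis 1 1) (axis 2 1) (axis 3 1)" for u v w
    by (intro wedge_eq_det linear_ext_deriv[OF ch U pU] ext_deriv_skew lin pU d\<eta>)
  have "volume_form g c p (T c p) (N c p) (B c p) = 1"
    using frame[OF pU] by (intro volume_form_orthonormal_frame m(1)[OF p] m(2)[OF p]) auto
  then have "wedge \<eta> (ext_deriv \<eta>) c p u v w
      = wedge \<eta> (ext_deriv \<eta>) c p (T c p) (N c p) (B c p) * volume_form g c p u v w"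
    by (simp add: det[of u v w] det[of "T c p" "N c p" "B c p"] volume_form_def mult.commute)
  then show ?thesis unfolding frame_value unfolding \<eta>_def .
qed

section \<open>Smooth functions on open sets of Euclidean space\<close>

lemma frechet_derivative_cong_open:
  assumes "open S" "x \<in> S" "\<And>y. y \<in> S \<Longrightarrow> f y = g y" "f differentiable (at x)"
  shows "g differentiable (at x)" "frechet_derivative g (at x) = frechet_derivative f (at x)"
proof -
  have "(g has_derivative frechet_derivative f (at x)) (at x)"
    by (rule has_derivative_transform_within_open[OF _ assms(1,2,3)])
      (rule assms(4)[unfolded frechet_derivative_works])
  then show "g differentiable (at x)" "frechet_derivative g (at x) = frechet_derivative f (at x)"
    using frechet_derivative_at[of g _ x, symmetric] by (simp_all add: differentiable_def exI)
qed

lemma has_frechet_derivative: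
  "f differentiable (at x) \<Longrightarrow> (f has_derivative frechet_derivative f (at x)) (at x)"
  by (simp only: frechet_derivative_works[symmetric])

lemma Ck_on_cong:
  assumes "open S"
  shows "Ck_on n S f \<Longrightarrow> (\<And>x. x \<in> S \<Longrightarrow> f x = g x) \<Longrightarrow> Ck_on n S g"
proof (induction n arbitrary: f g)
  case 0
  then show ?case using continuous_on_cong[of S S f g] by simp
next
  case (Suc n)
  note eq = frechet_derivative_cong_open[OF assms _ Suc.prems(2)]
  have d: "f differentiable (at x)" if "x \<in> S" for x using Suc.prems(1) that by simp
  have "Ck_on n S (\<lambda>x. frechet_derivative g (at x) (axis i 1))" for i
    by (rule Suc.IH[of "\<lambda>x. frechet_derivative f (at x) (axis i 1)"])
      (use Suc.prems(1) eq(2) d in auto)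
  then show ?case using eq(1) d by simp
qed

lemma Ck_on_bounded_linear:
  assumes "open S" "bounded_linear L"
  shows "Ck_on n S f \<Longrightarrow> Ck_on n S (\<lambda>x. L (f x))"
proof (induction n arbitrary: f)
  case 0
  then show ?case using bounded_linear.continuous_on[OF assms(2)] by simp
next
  case (Suc n)
  have d: "((\<lambda>x. L (f x)) has_derivative (\<lambda>v. L (frechet_derivative f (at x) v))) (at x)"
    if "x \<in> S" for x
    using Suc.prems that by (intro bounded_linear.has_derivative[OF assms(2)] has_frechet_derivative) simp
  have "Ck_on n S (\<lambda>x. frechet_derivative (\<lambda>x. L (f x)) (at x) (axis i 1))" for i
    by (rule Ck_on_cong[OF assms(1) Suc.IH, of "\<lambda>x. frechet_derivative f (at x) (axis i 1)"])
      (use Suc.prems in \<open>simp_all add: frechet_derivative_at[OF d, symmetric]\<close>)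
  then show ?case using d by (auto simp: differentiable_def)
qed

lemma Ck_on_const: "Ck_on n S (\<lambda>x. a)"
  by (induction n arbitrary: a) (simp_all add: frechet_derivative_const)

lemma Ck_on_Un: "open S \<Longrightarrow> open S' \<Longrightarrow> Ck_on n S f \<Longrightarrow> Ck_on n S' f \<Longrightarrow> Ck_on n (S \<union> S') f"
  by (induction n arbitrary: f) (auto intro: continuous_on_open_Un)

text \<open>The function \<open>flat 0\<close> is the usual source of bump functions: smooth, and positive exactly on the
  positive half-line. The powers of \<open>t\<close> are included because the family is then closed under
  differentiation up to linear combinations.\<close>

definition flat :: "nat \<Rightarrow> real \<Rightarrow> real" where
  "flat n t = (if t > 0 then exp (- 1 / t) / t ^ n else 0)"

lemma flat_tendsto_0: "(flat n \<longlongrightarrow> 0) (at 0)"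
proof -
  have "((\<lambda>x::real. x ^ n / exp x) \<longlongrightarrow> 0) at_top"
    by (rule tendsto_power_div_exp_0)
  from filterlim_compose[OF this filterlim_inverse_at_top_right]
  have "((\<lambda>t::real. inverse t ^ n / exp (inverse t)) \<longlongrightarrow> 0) (at_right 0)" .
  then have "(flat n \<longlongrightarrow> 0) (at_right 0)"
    by (rule Lim_transform_eventually)
      (auto simp: eventually_at_filter flat_def exp_minus field_simps)
  moreover have "(flat n \<longlongrightarrow> 0) (at_left 0)"
    by (rule Lim_transform_eventually[OF tendsto_const])
      (auto simp: eventually_at_filter flat_def)
  ultimately show ?thesis using filterlim_at_split by blast
qed

text \<open>At \<open>t = 0\<close> the difference quotient of \<open>flat n\<close> is \<open>flat (n + 1)\<close>, which tends to 0.\<close>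

lemma flat_has_derivative:
  "(flat n has_real_derivative (flat (n + 2) t - n * flat (n + 1) t)) (at t)"
proof -
  consider "t > 0" | "t = 0" | "t < 0" by linarith
  then show ?thesis
  proof cases
    case 1
    have pow: "real n * t ^ (n - Suc 0) = real n * t ^ n / t"
      using 1 by (cases n) auto
    have "((\<lambda>t. exp (- 1 / t)) has_real_derivative exp (- 1 / t) / t\<^sup>2) (at t)"
      using 1 by (auto intro!: derivative_eq_intros simp: power2_eq_square)
    from DERIV_divide[OF this DERIV_pow[of n t]] 1
    have "((\<lambda>t. exp (- 1 / t) / t ^ n) has_real_derivative
        (exp (- 1 / t) / t\<^sup>2 * t ^ n - exp (- 1 / t) * (real n * t ^ n / t)) / (t ^ n * t ^ n)) (at t)"
      by (simp add: pow)
    also have "(exp (- 1 / t) / t\<^sup>2 * t ^ n - exp (- 1 / t) * (real n * t ^ n / t)) / (t ^ n * t ^ n)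
        = flat (n + 2) t - n * flat (n + 1) t"
      using 1 by (simp add: flat_def divide_simps power2_eq_square) (simp add: algebra_simps)
    finally
    have "((\<lambda>t. exp (- 1 / t) / t ^ n) has_real_derivative flat (n + 2) t - n * flat (n + 1) t) (at t)"
      .
    then show ?thesis
      by (rule has_field_derivative_transform_within_open[of _ _ _ "{0<..}"])
        (use 1 in \<open>auto simp: flat_def\<close>)
  next
    case 2
    have "((\<lambda>h. (flat n (0 + h) - flat n 0) / h) \<longlongrightarrow> 0) (at 0)"
      by (rule Lim_transform_eventually[OF flat_tendsto_0[of "Suc n"]])
        (auto simp: eventually_at_filter flat_def)
    then show ?thesis using 2 by (simp add: has_field_derivative_def[symmetric] DERIV_def flat_def)
  next
    case 3
    have "((\<lambda>t. 0) has_real_derivative flat (n + 2) t - n * flat (n + 1) t) (at t)"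
      using 3 by (simp add: flat_def)
    then show ?thesis
      by (rule has_field_derivative_transform_within_open[of _ _ _ "{..<0}"])
        (use 3 in \<open>auto simp: flat_def\<close>)
  qed
qed

text \<open>A recursive definition of smoothness makes the product and chain rules awkward: an induction on the
  order of differentiability has to treat each operation separately. Instead, a class of functions is
  closed under all operations needed at once; each partial derivative of a member is again a member, and
  this alone forces every member to be smooth.\<close>

inductive smooth_closure :: "(real^'n) set \<Rightarrow> (real^'n \<Rightarrow> real) \<Rightarrow> bool" for S where
  base: "Cinf_on S f \<Longrightarrow> smooth_closure S f"
| cong: "smooth_closure S f \<Longrightarrow> (\<forall>x\<in>S. f x = g x) \<Longrightarrow> smooth_closure S g"
| add: "smooth_closure S f \<Longrightarrow> smooth_closure S g \<Longrightarrow> smooth_closure S (\<lambda>x. f x + g x)"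
| mult: "smooth_closure S f \<Longrightarrow> smooth_closure S g \<Longrightarrow> smooth_closure S (\<lambda>x. f x * g x)"
| inverse: "smooth_closure S f \<Longrightarrow> (\<forall>x\<in>S. f x \<noteq> 0) \<Longrightarrow> smooth_closure S (\<lambda>x. inverse (f x))"
| flat: "smooth_closure S f \<Longrightarrow> smooth_closure S (\<lambda>x. flat n (f x))"

lemma smooth_closure_const: "smooth_closure S (\<lambda>x. a)"
  by (rule smooth_closure.base) (simp add: Cinf_on_def Ck_on_const)

lemma smooth_closure_diff:
  "smooth_closure S f \<Longrightarrow> smooth_closure S g \<Longrightarrow> smooth_closure S (\<lambda>x. f x - g x)"
  using smooth_closure.add[OF _ smooth_closure.mult[OF smooth_closure_const[of S "-1"]], of f g]
  by simp

lemma smooth_closure_sum: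
  "(\<And>i. i \<in> I \<Longrightarrow> smooth_closure S (f i)) \<Longrightarrow> smooth_closure S (\<lambda>x. \<Sum>i\<in>I. f i x)"
  by (induction I rule: infinite_finite_induct)
    (auto intro: smooth_closure_const smooth_closure.add)

lemma smooth_closure_partial:
  assumes "open S" "smooth_closure S f"
  shows "(\<forall>x\<in>S. f differentiable (at x)) \<and>
    smooth_closure S (\<lambda>x. frechet_derivative f (at x) (axis i 1))"
  using assms(2)
proof induction
  case (base f)
  have 1: "Ck_on (Suc n) S f" for n using base unfolding Cinf_on_def by blast
  then show ?case by (auto intro!: smooth_closure.base simp: Cinf_on_def)
next
  case (cong f g)
  have "\<And>x. x \<in> S \<Longrightarrow> f x = g x" using cong by auto
  note eq = frechet_derivative_cong_open[OF assms(1) _ this]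
  have "smooth_closure S (\<lambda>x. frechet_derivative g (at x) (axis i 1))"
    by (rule smooth_closure.cong[OF cong.IH[THEN conjunct2]]) (use eq(2) cong.IH in auto)
  then show ?case using eq(1) cong.IH by auto
next
  case (add f g)
  have "((\<lambda>x. f x + g x) has_derivative
      (\<lambda>v. frechet_derivative f (at x) v + frechet_derivative g (at x) v)) (at x)" if "x \<in> S" for x
    using add.IH that by (intro has_derivative_add has_frechet_derivative) simp_all
  note d = this
  have "smooth_closure S (\<lambda>x. frechet_derivative (\<lambda>x. f x + g x) (at x) (axis i 1))"
    by (rule smooth_closure.cong[OF smooth_closure.add[OF add.IH[THEN conjunct2]]])
      (simp add: frechet_derivative_at[OF d, symmetric])
  then show ?case using d by (auto simp: differentiable_def)
next
  case (mult f g)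
  have "((\<lambda>x. f x * g x) has_derivative
      (\<lambda>v. f x * frechet_derivative g (at x) v + frechet_derivative f (at x) v * g x)) (at x)"
    if "x \<in> S" for x
    using mult.IH that by (intro has_derivative_mult has_frechet_derivative) simp_all
  note d = this
  have "smooth_closure S (\<lambda>x. frechet_derivative (\<lambda>x. f x * g x) (at x) (axis i 1))"
    by (rule smooth_closure.cong[OF smooth_closure.add[OF
          smooth_closure.mult[OF mult.hyps(1) mult.IH(2)[THEN conjunct2]]
          smooth_closure.mult[OF mult.IH(1)[THEN conjunct2] mult.hyps(2)]]])
      (simp add: frechet_derivative_at[OF d, symmetric])
  then show ?case using d by (auto simp: differentiable_def)
next
  case (inverse f)
  have "((\<lambda>x. inverse (f x)) has_derivative
      (\<lambda>v. -1 * (inverse (f x) * frechet_derivative f (at x) v * inverse (f x)))) (at x)"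
    if "x \<in> S" for x
    using Deriv.has_derivative_inverse[OF _ has_frechet_derivative, of f x] inverse that by simp
  note d = this
  have "smooth_closure S (\<lambda>x. frechet_derivative (\<lambda>x. inverse (f x)) (at x) (axis i 1))"
    by (rule smooth_closure.cong[OF smooth_closure.mult[OF smooth_closure_const[of S "-1"]
          smooth_closure.mult[OF smooth_closure.mult[OF
            smooth_closure.inverse[OF inverse.hyps] inverse.IH[THEN conjunct2]]
            smooth_closure.inverse[OF inverse.hyps]]]])
      (simp add: frechet_derivative_at[OF d, symmetric])
  then show ?case using d by (auto simp: differentiable_def)
next
  case (flat f n)
  have "((\<lambda>x. flat n (f x)) has_derivative
      (\<lambda>v. frechet_derivative f (at x) v * (flat (n + 2) (f x) - n * flat (n + 1) (f x)))) (at x)"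
    if "x \<in> S" for x
    using has_derivative_compose[OF has_frechet_derivative[of f x]
        flat_has_derivative[of n "f x", unfolded has_field_derivative_def]] flat.IH that
    by (simp add: mult.commute)
  note d = this
  have "smooth_closure S (\<lambda>x. frechet_derivative (\<lambda>x. flat n (f x)) (at x) (axis i 1))"
    by (rule smooth_closure.cong[OF smooth_closure.mult[OF flat.IH[THEN conjunct2]
          smooth_closure_diff[OF smooth_closure.flat[OF flat.hyps, of "n + 2"]
            smooth_closure.mult[OF smooth_closure_const[of S "real n"]
              smooth_closure.flat[OF flat.hyps, of "n + 1"]]]]])
      (simp add: frechet_derivative_at[OF d, symmetric])
  then show ?case using d by (auto simp: differentiable_def)
qed

lemma smooth_closure_imp_Cinf_on:
  assumes "open S" "smooth_closure S f"
  shows "Cinf_on S f"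
proof -
  have "Ck_on n S f" for n
    using assms(2)
  proof (induction n arbitrary: f)
    case 0
    then show ?case
      using smooth_closure_partial[OF assms(1) 0]
      by (auto intro!: continuous_at_imp_continuous_on differentiable_imp_continuous_within)
  next
    case (Suc n)
    then show ?case using smooth_closure_partial[OF assms(1) Suc.prems] by auto
  qed
  then show ?thesis by (simp add: Cinf_on_def)
qed

section \<open>Partitions of unity and integration\<close>

text \<open>The function is \<open>flat 0 (r\<^sup>2 - d\<^sup>2)\<close> with \<open>d\<close> the coordinate distance from \<open>p\<close>, extended by 0. Its
  support lies in the preimage \<open>K\<close> of a closed ball, which is compact and hence closed since \<open>M\<close> is
  Hausdorff. In another chart, smoothness is checked separately on the two open sets \<open>chart_dom c\<close> and
  \<open>- K\<close>, which cover \<open>M\<close>.\<close>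

lemma bump_function_exists:
  fixes A :: "('a::{t2_space,second_countable_topology}) chart set"
  assumes at: "oriented_atlas A" and c: "c \<in> A" and p: "p \<in> chart_dom c"
  obtains b V where "\<forall>c'\<in>A. smooth_in_chart c' UNIV b" "\<forall>q. 0 \<le> b q"
    "closure {q. b q \<noteq> 0} \<subseteq> chart_dom c" "open V" "p \<in> V" "\<forall>q\<in>V. 0 < (b q :: real)"
proof -
  let ?m = "chart_map c"
  have ch: "is_chart c'" if "c' \<in> A" for c'
    using at that unfolding oriented_atlas_def by blast
  have open_image: "open (?m ` chart_dom c)" and open_dom: "open (chart_dom c)"
    and cont: "continuous_on (chart_dom c) ?m"
    and cont_inv: "continuous_on (?m ` chart_dom c) (chart_inv c)"
    using ch[OF c] by (auto simp: is_chart_def homeomorphism_def)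
  define x0 where "x0 = ?m p"
  obtain r where r: "r > 0" "cball x0 r \<subseteq> ?m ` chart_dom c"
    using open_contains_cball[of "?m ` chart_dom c"] open_image p unfolding x0_def by blast
  define K where "K = chart_inv c ` cball x0 r"
  have K_dom: "K \<subseteq> chart_dom c"
    using r(2) chart_inv_mem[OF _ order_refl ch[OF c]] unfolding K_def by blast
  have "compact K"
    unfolding K_def by (rule compact_continuous_image[OF continuous_on_subset[OF cont_inv r(2)]]) simp
  then have K_closed: "closed K" by (rule compact_imp_closed)
  define b where "b q = (if q \<in> chart_dom c
      then flat 0 (r\<^sup>2 - (\<Sum>i\<in>UNIV. (?m q $ i - x0 $ i) * (?m q $ i - x0 $ i))) else 0)" for q
  have dist: "(\<Sum>i\<in>UNIV. (x $ i - x0 $ i) * (x $ i - x0 $ i)) = (dist x0 x)\<^sup>2" for x :: "real^3"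
    by (simp add: dist_norm power2_norm_eq_inner inner_vec_def norm_minus_commute[of x0])
  have pos: "0 < b q \<longleftrightarrow> q \<in> chart_dom c \<and> ?m q \<in> ball x0 r" for q
    using r(1) power2_less_imp_less[of "dist x0 (?m q)" r] power_strict_mono[of "dist x0 (?m q)" r 2]
    by (auto simp: b_def dist flat_def)
  have nonneg: "0 \<le> b q" for q by (simp add: b_def flat_def)
  have "q \<in> K" if "b q \<noteq> 0" for q
  proof -
    have "0 < b q" using that nonneg[of q] by linarith
    then have "q \<in> chart_dom c" "?m q \<in> cball x0 r" using pos by auto
    then show "q \<in> K"
      unfolding K_def using chart_inv_chart_map[OF ch[OF c]] by force
  qed
  then have supp: "{q. b q \<noteq> 0} \<subseteq> K" by blast
  have smooth: "smooth_in_chart c' UNIV b" if c': "c' \<in> A" for c'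
  proof -
    let ?m' = "chart_map c'"
    let ?S = "?m' ` (chart_dom c \<inter> chart_dom c')" and ?S' = "?m' ` (- K \<inter> chart_dom c')"
    have S: "open ?S" "open ?S'"
      using open_chart_image[OF ch[OF c']] open_dom K_closed by blast+
    have "Cinf_on ?S (?m \<circ> chart_inv c')"
      using at c c' unfolding oriented_atlas_def smooth_in_chart_def by blast
    then have "smooth_closure ?S (\<lambda>x. ?m (chart_inv c' x) $ i)" for i
      using Ck_on_bounded_linear[OF S(1) bounded_linear_vec_nth]
      by (intro smooth_closure.base) (auto simp: Cinf_on_def o_def)
    then have "smooth_closure ?S (\<lambda>x. flat 0 (r\<^sup>2 - (\<Sum>i\<in>UNIV.
        (?m (chart_inv c' x) $ i - x0 $ i) * (?m (chart_inv c' x) $ i - x0 $ i))))"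
      by (intro smooth_closure.flat smooth_closure_diff smooth_closure_sum smooth_closure.mult
          smooth_closure_const)
    then have "smooth_closure ?S (b \<circ> chart_inv c')"
      by (rule smooth_closure.cong) (auto simp: b_def chart_inv_chart_map[OF ch[OF c']])
    moreover have "smooth_closure ?S' (b \<circ> chart_inv c')"
      by (rule smooth_closure.cong[OF smooth_closure_const[of _ 0]])
        (use supp in \<open>auto simp: chart_inv_chart_map[OF ch[OF c']]\<close>)
    ultimately have "Cinf_on (?S \<union> ?S') (b \<circ> chart_inv c')"
      using smooth_closure_imp_Cinf_on[OF S(1)] smooth_closure_imp_Cinf_on[OF S(2)]
        Ck_on_Un[OF S, where f = "b \<circ> chart_inv c'"]
      by (simp add: Cinf_on_def)
    moreover have "?S \<union> ?S' = ?m' ` (UNIV \<inter> chart_dom c')" using K_dom by auto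
    ultimately show ?thesis by (simp add: smooth_in_chart_def)
  qed
  have "open (chart_dom c \<inter> ?m -` ball x0 r)"
    by (rule continuous_open_preimage[OF cont open_dom open_ball])
  moreover have "p \<in> chart_dom c \<inter> ?m -` ball x0 r" using p r(1) by (simp add: x0_def)
  moreover have "closure {q. b q \<noteq> 0} \<subseteq> chart_dom c"
    using closure_minimal[OF supp K_closed] K_dom by blast
  ultimately show thesis
    using smooth nonneg pos by (intro that[of b "chart_dom c \<inter> ?m -` ball x0 r"]) auto
qed

text \<open>The partition is indexed by charts, not by the points of the finite cover: bump functions that
  live in the same chart are added up before dividing by the total sum \<open>s\<close>.\<close>

lemma partition_of_unity_exists:
  fixes A :: "('a::{t2_space,second_countable_topology}) chart set"
  assumes at: "oriented_atlas A" and compact: "compact (UNIV :: 'a set)"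
  shows "\<exists>F \<rho>. partition_of_unity A F \<rho>"
proof -
  have "\<exists>c b V. c \<in> A \<and> (\<forall>c'\<in>A. smooth_in_chart c' UNIV b) \<and> (\<forall>q. 0 \<le> b q) \<and>
    closure {q. b q \<noteq> 0} \<subseteq> chart_dom c \<and> open V \<and> p \<in> V \<and> (\<forall>q\<in>V. 0 < (b q :: real))" for p
  proof -
    have "p \<in> (\<Union>c\<in>A. chart_dom c)" using at by (simp add: oriented_atlas_def)
    then obtain c where "c \<in> A" "p \<in> chart_dom c" by blast
    then show ?thesis using bump_function_exists[OF at, of c p] by metis
  qed
  then obtain c b V where bump: "\<And>p. c p \<in> A \<and> (\<forall>c'\<in>A. smooth_in_chart c' UNIV (b p)) \<and>
    (\<forall>q. 0 \<le> b p q) \<and> closure {q. b p q \<noteq> 0} \<subseteq> chart_dom (c p) \<and>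
    open (V p) \<and> p \<in> V p \<and> (\<forall>q\<in>V p. 0 < (b p q :: real))"
    by metis
  obtain P where P: "finite P" "(UNIV :: 'a set) \<subseteq> (\<Union>p\<in>P. V p)"
    by (rule compactE_image[OF compact, of UNIV V]) (use bump in auto)
  define s where "s q = (\<Sum>p\<in>P. b p q)" for q
  have s: "s q > 0" for q
  proof -
    obtain p where "p \<in> P" "q \<in> V p" using P(2) by blast
    then show ?thesis using bump P(1) unfolding s_def by (intro sum_pos2[of P p]) auto
  qed
  define Q where "Q d = {p \<in> P. c p = d}" for d
  have Q: "finite (Q d)" for d using P(1) by (simp add: Q_def)
  define \<rho> where "\<rho> d q = (\<Sum>p\<in>Q d. b p q) * inverse (s q)" for d q
  have "smooth_in_chart c' UNIV (\<rho> d)" if c': "c' \<in> A" for c' d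
  proof -
    let ?S = "chart_map c' ` (UNIV \<inter> chart_dom c')"
    have op: "open ?S"
      using open_chart_image at c' unfolding oriented_atlas_def by blast
    have "smooth_closure ?S (\<lambda>x. b p (chart_inv c' x))" for p
      using bump c' by (intro smooth_closure.base) (auto simp: smooth_in_chart_def o_def)
    then have "smooth_closure ?S (\<lambda>x. \<rho> d (chart_inv c' x))"
      unfolding \<rho>_def s_def
      by (intro smooth_closure.mult smooth_closure.inverse smooth_closure_sum)
        (use s in \<open>auto simp: s_def less_le\<close>)
    from smooth_closure_imp_Cinf_on[OF op this] show ?thesis
      by (simp add: smooth_in_chart_def o_def)
  qed
  moreover have "0 \<le> \<rho> d q" for d q
    using bump less_imp_le[OF s[of q]] unfolding \<rho>_def by (intro mult_nonneg_nonneg sum_nonneg) auto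
  moreover have "closure {q. \<rho> d q \<noteq> 0} \<subseteq> chart_dom d" for d
  proof -
    have "{q. \<rho> d q \<noteq> 0} \<subseteq> (\<Union>p\<in>Q d. closure {q. b p q \<noteq> 0})"
    proof
      fix q assume "q \<in> {q. \<rho> d q \<noteq> 0}"
      then have "(\<Sum>p\<in>Q d. b p q) \<noteq> 0" by (auto simp: \<rho>_def)
      then obtain p where "p \<in> Q d" "b p q \<noteq> 0" by (meson sum.not_neutral_contains_not_neutral)
      then show "q \<in> (\<Union>p\<in>Q d. closure {q. b p q \<noteq> 0})"
        using closure_subset[of "{q. b p q \<noteq> 0}"] by blast
    qed
    then have "closure {q. \<rho> d q \<noteq> 0} \<subseteq> (\<Union>p\<in>Q d. closure {q. b p q \<noteq> 0})"
      by (rule closure_minimal) (intro closed_UN Q ballI closed_closure)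
    moreover have "closure {q. b p q \<noteq> 0} \<subseteq> chart_dom d" if "p \<in> Q d" for p
      using bump[of p] that by (simp add: Q_def)
    ultimately show ?thesis by blast
  qed
  moreover have "(\<Sum>d\<in>c ` P. \<rho> d q) = 1" for q
  proof -
    have "(\<Sum>d\<in>c ` P. \<Sum>p\<in>Q d. b p q) = s q"
      unfolding s_def Q_def by (rule sum.group) (use P in auto)
    then show ?thesis using s[of q] by (simp add: \<rho>_def sum_distrib_right[symmetric])
  qed
  moreover have "finite (c ` P)" "c ` P \<subseteq> A" using P bump by auto
  ultimately have "partition_of_unity A (c ` P) \<rho>" by (simp add: partition_of_unity_def)
  then show ?thesis by blast
qed

text \<open>Compactness enters only through the existence of a partition of unity: it ensures that the chosen
  one consists of charts of the atlas, where the hypothesis on the two forms applies. Negation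
  commutes with the Bochner integral for arbitrary functions, the value being 0 for non-integrable ones.\<close>

lemma form_integral_minus:
  fixes A :: "('a::{t2_space,second_countable_topology}) chart set"
  assumes "oriented_atlas A" "compact (UNIV :: 'a set)"
    and eq: "\<And>c p u v w. c \<in> A \<Longrightarrow> p \<in> chart_dom c \<Longrightarrow> \<theta> c p u v w = - \<theta>' c p u v w"
  shows "form_integral A \<theta> = - form_integral A \<theta>'"
proof -
  define P where "P = (SOME (F, \<rho>). partition_of_unity A F \<rho>)"
  obtain F \<rho> where P: "P = (F, \<rho>)" by (cases P)
  have "\<exists>P. case P of (F, \<rho>) \<Rightarrow> partition_of_unity A F \<rho>"
    using partition_of_unity_exists[OF assms(1,2)] by auto
  from someI_ex[OF this] have F: "F \<subseteq> A"
    unfolding P_def[symmetric] P by (simp add: partition_of_unity_def)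
  let ?I = "\<lambda>\<theta> c. LINT x:chart_map c ` chart_dom c|lborel.
        \<rho> c (chart_inv c x) * \<theta> c (chart_inv c x) (axis 1 1) (axis 2 1) (axis 3 1)"
  have "?I \<theta> c = - ?I \<theta>' c" if "c \<in> F" for c
  proof -
    have c: "c \<in> A" "is_chart c"
      using that F assms(1) unfolding oriented_atlas_def by blast+
    have "?I \<theta> c = (LINT x|lborel. - (indicator (chart_map c ` chart_dom c) x *\<^sub>R
        (\<rho> c (chart_inv c x) * \<theta>' c (chart_inv c x) (axis 1 1) (axis 2 1) (axis 3 1))))"
      unfolding set_lebesgue_integral_def
    proof (rule Bochner_Integration.integral_cong[OF refl])
      fix x
      have "\<theta> c (chart_inv c x) u v w = - \<theta>' c (chart_inv c x) u v w"
        if "x \<in> chart_map c ` chart_dom c" for u v w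
        using eq[OF c(1) chart_inv_mem[OF that order_refl c(2)]] .
      then show "indicator (chart_map c ` chart_dom c) x *\<^sub>R
            (\<rho> c (chart_inv c x) * \<theta> c (chart_inv c x) (axis 1 1) (axis 2 1) (axis 3 1))
          = - (indicator (chart_map c ` chart_dom c) x *\<^sub>R
            (\<rho> c (chart_inv c x) * \<theta>' c (chart_inv c x) (axis 1 1) (axis 2 1) (axis 3 1)))"
        by (simp add: indicator_def)
    qed
    then show ?thesis by (simp add: set_lebesgue_integral_def)
  qed
  then have "(\<Sum>c\<in>F. ?I \<theta> c) = - (\<Sum>c\<in>F. ?I \<theta>' c)"
    by (simp add: sum_negf[symmetric])
  then show ?thesis
    unfolding form_integral_def P_def[symmetric] P by simp
qed

section \<open>The Godbillon-Vey invariant\<close>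

theorem mainTheorem7:
  fixes A :: "('a::{t2_space,second_countable_topology}) chart set"
    and D :: "'a chart \<Rightarrow> 'a \<Rightarrow> (real^3) set"
    and T N B :: "'a vfield"
    and g :: "'a metric_field"
    and \<Gamma> :: "'a conn"
    and k \<tau> :: "'a \<Rightarrow> real"
  assumes "oriented_atlas A"
    and "plane_field A D"
    and "vector_field A UNIV T"
    and "transverse A D T"
    and "riemannian_metric A g"
    and "compatible_metric A D T g"
    and "levi_civita A g \<Gamma>"
    and "frenet_apparatus A g \<Gamma> T k N B \<tau>"
  shows "(\<forall>c\<in>A. \<forall>p\<in>chart_dom c. k p \<noteq> 0 \<longrightarrow> (\<forall>u v w.
            wedge (eta_form D T) (ext_deriv (eta_form D T)) c p u v w =
            - (k p)\<^sup>2 * (\<tau> p - second_fund_form g \<Gamma> T B N c p) * volume_form g c p u v w)) \<and>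
         (compact (UNIV :: 'a set) \<longrightarrow>
            godbillon_vey A D T =
            - form_integral A (\<lambda>c p u v w. if k p = 0 then 0
                else (k p)\<^sup>2 * (\<tau> p - second_fund_form g \<Gamma> T B N c p) * volume_form g c p u v w))"
proof (intro conjI ballI allI impI)
  fix c p u v w
  assume "c \<in> A" "p \<in> chart_dom c" "k p \<noteq> 0"
  then show "wedge (eta_form D T) (ext_deriv (eta_form D T)) c p u v w =
      - (k p)\<^sup>2 * (\<tau> p - second_fund_form g \<Gamma> T B N c p) * volume_form g c p u v w"
    by (rule wedge_eta_form_eq[OF assms])
next
  assume "compact (UNIV :: 'a set)"
  then show "godbillon_vey A D T =
      - form_integral A (\<lambda>c p u v w. if k p = 0 then 0
          else (k p)\<^sup>2 * (\<tau> p - second_fund_form g \<Gamma> T B N c p) * volume_form g c p u v w)"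
    unfolding godbillon_vey_def
  proof (rule form_integral_minus[OF assms(1)])
    fix c p u v w
    assume c: "c \<in> A" and p: "p \<in> chart_dom c"
    show "wedge (eta_form D T) (ext_deriv (eta_form D T)) c p u v w =
        - (if k p = 0 then 0
           else (k p)\<^sup>2 * (\<tau> p - second_fund_form g \<Gamma> T B N c p) * volume_form g c p u v w)"
    proof (cases "k p = 0")
      case True
      have "g c p (cov_deriv \<Gamma> T T c p) (cov_deriv \<Gamma> T T c p) = 0"
        using assms(8)[unfolded frenet_apparatus_def, THEN conjunct1] c p True by simp
      moreover have "\<forall>u. u \<noteq> 0 \<longrightarrow> g c p u u > 0"
        using assms(5)[unfolded riemannian_metric_def, THEN conjunct1] c p by blast
      ultimately have "cov_deriv \<Gamma> T T c p = 0" by fastforce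
      then have "eta_form D T c p x = 0" for x
        using eta_form_eq_curvature[OF assms(1-7) c p, of x]
          linear_0[OF riemannian_metric_at(4)[OF assms(5) c p, of x]] by simp
      then show ?thesis using True by (simp add: wedge_def)
    next
      case False
      then show ?thesis using wedge_eta_form_eq[OF assms c p False] by simp
    qed
  qed
qed

end
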